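(* For each positive integer $j$ define $$F_j(q)=\sum_{m=0}^{j+1}\sum_{n=0}^{j+1}\frac{(-1)^{\frac{3n}{2}}q^{\frac12(n^2-2n+2)}(-1)^{\frac m2}q^{\frac12(m^2-2m)}}{q+1}{j+1\brack n}_q{j+1\brack m}_q .$$ Then the Pell constant satisfies $\mathcal{P}_{Pell}=1-\lim_{j\to\infty}F_j(-\tfrac12)$, and $\mathcal{P}_{Pell}\approx 0.58057$.
   Context: The Gaussian binomial coefficient is ${m\brack n}_q=\frac{(1-q)(1-q^2)\cdots(1-q^m)}{(1-q)\cdots(1-q^n)\,(1-q)\cdots(1-q^{m-n})}$ for $0\le n\le m$, and $0$ for $n>m$. Half-integer powers are interpreted via fixed square roots: choose $i$ with $i^2=-1$ and $s$ with $s^2=q$, and set $(-1)^{a/2}=i^{a}$ and $q^{b/2}=s^{b}$ for integers $a,b$. The Pell constant is $\mathcal{P}_{Pell}=1-\prod_{k=0}^{\infty}\left(1-\frac{1}{2^{2k+1}}\right)$. *)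

theory Defs
  imports "HOL-Analysis.Analysis"
begin

(* Evaluated pointwise, so this is the Gaussian binomial only where 1 - q^k is nonzero
   for 1 <= k <= m (in particular at q = -1/2); at other points x / 0 = 0 applies. *)
definition gauss_binomial :: "'a::field \<Rightarrow> nat \<Rightarrow> nat \<Rightarrow> 'a" where
  "gauss_binomial q m n =
    (if n \<le> m
     then (\<Prod>k=1..m. 1 - q ^ k) / ((\<Prod>k=1..n. 1 - q ^ k) * (\<Prod>k=1..m - n. 1 - q ^ k))
     else 0)"

(* The parameters are meant to satisfy i^2 = -1 and s^2 = q, so that (-1)^(a/2) is
   i powi a and q^(b/2) is s powi b. Integer exponents are needed: m^2 - 2m = -1 at m = 1. *)
definition F :: "complex \<Rightarrow> complex \<Rightarrow> complex \<Rightarrow> nat \<Rightarrow> complex" where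
  "F i s q j =
    (\<Sum>m=0..j+1. \<Sum>n=0..j+1.
       (i powi (3 * int n) * s powi ((int n)\<^sup>2 - 2 * int n + 2)
          * i powi (int m) * s powi ((int m)\<^sup>2 - 2 * int m)) / (q + 1)
       * gauss_binomial q (j + 1) n * gauss_binomial q (j + 1) m)"

definition pell_constant :: real where
  "pell_constant = 1 - (\<Prod>k. 1 - 1 / 2 ^ (2 * k + 1))"

end

theory Submission
  imports Defs
begin

text \<open>
  The double sum factors as q/(q+1) times two single sums, each of which the Gaussian
  (q-)binomial theorem evaluates: they equal the products over k < j+1 of
  1 - (i/s) q^k and 1 + (i/s) q^k. Their product is the product of 1 + q^(2k-1), whose factor
  at k = 0 cancels q/(q+1). At q = -1/2 the remaining factors are exactly those of the Pell
  product. For the numerical bounds, the partial products P(n) decrease to the limit, while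
  P(n) (1 - (4/3) / 2^(2n+1)) increases to it.
\<close>

lemma prod_one_minus_power_nonzero:
  fixes q :: "'a::field"
  assumes "\<And>k. 1 \<le> k \<Longrightarrow> q ^ k \<noteq> 1"
  shows "(\<Prod>k=1..n. 1 - q ^ k) \<noteq> 0"
  using assms by (force simp: prod_zero_iff)

lemma gauss_binomial_0:
  fixes q :: "'a::field"
  assumes "\<And>k. 1 \<le> k \<Longrightarrow> q ^ k \<noteq> 1"
  shows "gauss_binomial q m 0 = 1"
  using prod_one_minus_power_nonzero[OF assms, of m] by (simp add: gauss_binomial_def)

text \<open>The q-Pascal rule. Splitting 1 - q^(m+1) as (1 - q^(m-n)) + q^(m-n) (1 - q^(n+1)) lets
  each summand cancel one factor of the denominator.\<close>

lemma gauss_binomial_Suc_Suc: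
  fixes q :: "'a::field"
  assumes q: "\<And>k. 1 \<le> k \<Longrightarrow> q ^ k \<noteq> 1" and "n \<le> m"
  shows "gauss_binomial q (Suc m) (Suc n) =
    gauss_binomial q m (Suc n) + q ^ (m - n) * gauss_binomial q m n"
proof -
  define P where "P n = (\<Prod>k=1..n. 1 - q ^ k)" for n
  have PS: "P (Suc n) = P n * (1 - q ^ Suc n)" for n
    by (simp add: P_def)
  have P0: "P n \<noteq> 0" for n
    unfolding P_def using prod_one_minus_power_nonzero[OF q] .
  have q0: "1 - q ^ Suc n \<noteq> 0" for n
    using q[of "Suc n"] by simp
  have G: "gauss_binomial q m n = (if n \<le> m then P m / (P n * P (m - n)) else 0)" for m n
    by (simp add: gauss_binomial_def P_def)
  show ?thesis
  \<comment> \<open>In the boundary case the term \<open>gauss_binomial q m (Suc m)\<close> is 0 by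
    default and the other two are 1.\<close>
  proof (cases "n = m")
    case True
    moreover have "P 0 = 1" by (simp add: P_def)
    ultimately show ?thesis using P0 by (simp add: G)
  next
    case False
    then obtain d where m: "m = n + Suc d"
      using \<open>n \<le> m\<close> by (metis add_Suc_right less_iff_Suc_add le_neq_implies_less)
    have e: "1 - q ^ Suc m = (1 - q ^ Suc d) + q ^ Suc d * (1 - q ^ Suc n)"
      by (simp add: m power_add algebra_simps)
    have d: "Suc m - Suc n = Suc d" "m - Suc n = d" "m - n = Suc d"
      by (auto simp: m)
    have n: "Suc n \<le> m" "n \<le> m" "Suc n \<le> Suc m"
      by (auto simp: m)
    have "gauss_binomial q (Suc m) (Suc n) =
        P m * ((1 - q ^ Suc d) + q ^ Suc d * (1 - q ^ Suc n)) /
        (P n * (1 - q ^ Suc n) * (P d * (1 - q ^ Suc d)))"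
      unfolding G d PS e using n by simp
    also have "\<dots> = P m / (P n * (1 - q ^ Suc n) * P d) +
        q ^ Suc d * (P m / (P n * (P d * (1 - q ^ Suc d))))"
    proof -
      have "M * (u + w * v) / (p * v * (r * u)) = M / (p * v * r) + w * (M / (p * (r * u)))"
        if "p \<noteq> 0" "r \<noteq> 0" "u \<noteq> 0" "v \<noteq> 0" for M p r u v w :: 'a
        using that by (simp add: field_simps)
      then show ?thesis using P0 q0 by blast
    qed
    also have "\<dots> = gauss_binomial q m (Suc n) + q ^ (m - n) * gauss_binomial q m n"
      unfolding G d PS using n by simp
    finally show ?thesis .
  qed
qed

text \<open>Induction on \<open>N\<close>: by the q-Pascal rule, the terms for N + 1 are those for N
  plus a copy shifted by one index and scaled by x q^N, which amounts to multiplying the sum by 1 +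
  x q^N.\<close>

theorem gauss_binomial_theorem:
  fixes q x :: "'a::field"
  assumes q: "\<And>k. 1 \<le> k \<Longrightarrow> q ^ k \<noteq> 1"
  shows "(\<Sum>n=0..N. q ^ (n choose 2) * gauss_binomial q N n * x ^ n) = (\<Prod>k<N. 1 + x * q ^ k)"
proof (induction N)
  case 0
  then show ?case by (simp add: gauss_binomial_def binomial_eq_0)
next
  case (Suc N)
  define f where "f M n = q ^ (n choose 2) * gauss_binomial q M n * x ^ n" for M n
  have f0: "f M 0 = 1" for M
    by (simp add: f_def gauss_binomial_0[OF q] binomial_eq_0)
  have step: "f (Suc N) (Suc n) = f N (Suc n) + x * q ^ N * f N n" if "n \<le> N" for n
  proof -
    \<comment> \<open>Both exponents equal N + (n choose 2), so the scaling factor x q^N does not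
      depend on n and can leave the sum.\<close>
    have "q ^ (Suc n choose 2) * q ^ (N - n) = q ^ N * q ^ (n choose 2)"
      using that by (simp add: numeral_2_eq_2 add.commute flip: power_add)
    moreover have "f (Suc N) (Suc n) = f N (Suc n) +
        q ^ (Suc n choose 2) * q ^ (N - n) * (gauss_binomial q N n * x ^ Suc n)"
      by (simp add: f_def gauss_binomial_Suc_Suc[OF q that] distrib_left distrib_right mult.assoc
          del: power_Suc)
    ultimately show ?thesis
      by (simp add: f_def mult_ac)
  qed
  have last: "f N (Suc N) = 0"
    by (simp add: f_def gauss_binomial_def)
  have "(\<Sum>n=0..Suc N. f (Suc N) n) = f (Suc N) 0 + (\<Sum>n=0..N. f (Suc N) (Suc n))"
    by (rule sum.atLeast0_atMost_Suc_shift[unfolded o_def])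
  also have "(\<Sum>n=0..N. f (Suc N) (Suc n)) =
      (\<Sum>n=0..N. f N (Suc n)) + x * q ^ N * (\<Sum>n=0..N. f N n)"
    by (simp add: step sum.distrib sum_distrib_left)
  also have "f (Suc N) 0 + \<dots> =
      (\<Sum>n=0..Suc N. f N n) + x * q ^ N * (\<Sum>n=0..N. f N n)"
    unfolding sum.atLeast0_atMost_Suc_shift[of "f N" N] by (simp add: f0)
  also have "\<dots> = (1 + x * q ^ N) * (\<Sum>n=0..N. f N n)"
    by (simp add: last algebra_simps)
  also have "\<dots> = (\<Prod>k<Suc N. 1 + x * q ^ k)"
    using Suc.IH by (simp add: f_def mult.commute)
  finally show ?case
    by (simp add: f_def)
qed

text \<open>Since n^2 - 2n = 2 (n choose 2) - n, the half-integer power of q = s^2 takes the shape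
  of the q-binomial theorem at an argument proportional to 1/s.\<close>

lemma power_int_square_minus_double:
  fixes s :: "'a::field"
  assumes "s \<noteq> 0"
  shows "s powi ((int n)\<^sup>2 - 2 * int n) = (s\<^sup>2) ^ (n choose 2) * (1 / s) ^ n"
proof -
  have "2 * (n choose 2) = n * (n - 1)"
    by (cases n) (simp_all add: choose_two dvd_mult_div_cancel)
  then have "int (2 * (n choose 2)) = int n * (int n - 1)"
    by (cases n) (auto simp: algebra_simps)
  then have "(int n)\<^sup>2 - 2 * int n = int (2 * (n choose 2)) - int n"
    by (simp add: power2_eq_square algebra_simps)
  then have "s powi ((int n)\<^sup>2 - 2 * int n) = s ^ (2 * (n choose 2)) / s ^ n"
    by (simp only: power_int_diff[OF disjI1[OF assms]] power_int_of_nat)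
  then show ?thesis
    by (simp add: power_mult power_one_over)
qed

lemma F_eq_prod:
  fixes i s q :: complex
  assumes i: "i\<^sup>2 = -1" and s: "s\<^sup>2 = q" and "q \<noteq> 0" "q \<noteq> -1"
    and q: "\<And>k. 1 \<le> k \<Longrightarrow> q ^ k \<noteq> 1"
  shows "F i s q j = (\<Prod>k<j. 1 + q ^ (2 * k + 1))"
proof -
  have s0: "s \<noteq> 0" using s \<open>q \<noteq> 0\<close> by auto
  \<comment> \<open>This makes (-1)^(3n/2) equal to (-i)^n, so the two sums have opposite
    arguments.\<close>
  have i3: "i ^ 3 = - i" using i by (simp add: power3_eq_cube power2_eq_square)
  have q1: "q + 1 \<noteq> 0" using \<open>q \<noteq> -1\<close> by (simp add: add_eq_0_iff2)
  define t where "t y n = q ^ (n choose 2) * gauss_binomial q (j + 1) n * (y / s) ^ n" for y n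
  have sum_t: "(\<Sum>n=0..j+1. t y n) = (\<Prod>k<j+1. 1 + y / s * q ^ k)" for y
    unfolding t_def by (rule gauss_binomial_theorem[OF q])
  have powi3: "i powi (3 * int n) = (- i) ^ n" for n
    using i3 power_int_of_nat[of i "3 * n"] by (simp add: power_mult)
  have summand: "(i powi (3 * int n) * s powi ((int n)\<^sup>2 - 2 * int n + 2)
          * i powi (int m) * s powi ((int m)\<^sup>2 - 2 * int m)) / (q + 1)
       * gauss_binomial q (j + 1) n * gauss_binomial q (j + 1) m
     = q / (q + 1) * (t i m * t (- i) n)" for m n
    \<comment> \<open>The prefactor q is s^2, split off from the + 2 in the exponent.\<close>
    unfolding power_int_add[OF disjI1[OF s0]] powi3 power_int_square_minus_double[OF s0] t_def
    by (simp add: s power_divide ac_simps del: divide_minus_left)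
  have "F i s q j = q / (q + 1) * ((\<Sum>m=0..j+1. t i m) * (\<Sum>n=0..j+1. t (- i) n))"
    unfolding F_def summand sum_product by (simp only: sum_distrib_left)
  also have "(\<Sum>m=0..j+1. t i m) * (\<Sum>n=0..j+1. t (- i) n) =
      (\<Prod>k<Suc j. (1 + i / s * q ^ k) * (1 + (- i) / s * q ^ k))"
    unfolding sum_t by (simp only: prod.distrib Suc_eq_plus1)
  also have "\<dots> = (\<Prod>k<Suc j. 1 + q ^ (2 * k) / q)"
  proof (rule prod.cong)
    fix k
    have "(1 + i / s * q ^ k) * (1 + (- i) / s * q ^ k) = 1 - i\<^sup>2 / s\<^sup>2 * (q ^ k)\<^sup>2"
      by (simp add: algebra_simps power2_eq_square)
    then show "(1 + i / s * q ^ k) * (1 + (- i) / s * q ^ k) = 1 + q ^ (2 * k) / q"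
      by (simp add: i s power_even_eq)
  qed simp
  \<comment> \<open>The factor at k = 0 is 1 + 1/q; the shift k + 1 turns the others into 1 +
    q^(2k+1).\<close>
  also have "\<dots> = (q + 1) / q * (\<Prod>k<j. 1 + q ^ (2 * k + 1))"
    unfolding prod.lessThan_Suc_shift using \<open>q \<noteq> 0\<close>
    by (simp add: field_simps del: prod.lessThan_Suc)
  finally show ?thesis using \<open>q \<noteq> 0\<close> q1 by simp
qed

definition pell_prod :: "nat \<Rightarrow> real" where
  "pell_prod n = (\<Prod>k<n. 1 - 1 / 2 ^ (2 * k + 1))"

lemma pell_prod_Suc: "pell_prod (Suc n) = pell_prod n * (1 - 1 / 2 ^ (2 * n + 1))"
  by (simp add: pell_prod_def)

lemma pell_factor_pos: "0 < 1 - 1 / (2::real) ^ (2 * k + 1)"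
  using one_less_power[of "2::real" "2 * k + 1"] by (simp add: divide_less_eq_1 del: power_Suc)

lemma pell_prod_pos: "0 < pell_prod n"
  unfolding pell_prod_def using pell_factor_pos by (intro prod_pos) blast

lemma pell_prod_tendsto: "pell_prod \<longlonglongrightarrow> 1 - pell_constant"
proof -
  have "summable (\<lambda>k. 1 / 2 * (1 / 4 :: real) ^ k)"
    by (intro summable_mult summable_geometric) simp
  moreover have "norm ((1 - 1 / 2 ^ (2 * k + 1)) - (1::real)) = 1 / 2 * (1 / 4) ^ k" for k
    by (simp add: power_mult power_one_over)
  ultimately have "abs_convergent_prod (\<lambda>k. 1 - 1 / (2::real) ^ (2 * k + 1))"
    by (intro summable_imp_abs_convergent_prod) (simp only:)
  then have "convergent_prod (\<lambda>k. 1 - 1 / (2::real) ^ (2 * k + 1))"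
    by (rule abs_convergent_prod_imp_convergent_prod)
  \<comment> \<open>The library's partial products include the index n, hence
    \<open>pell_prod (Suc n)\<close>.\<close>
  from convergent_prod_LIMSEQ[OF this]
  have "(\<lambda>n. pell_prod (Suc n)) \<longlonglongrightarrow> 1 - pell_constant"
    by (simp add: pell_prod_def pell_constant_def lessThan_Suc_atMost del: prod.lessThan_Suc)
  then show ?thesis by (rule LIMSEQ_imp_Suc)
qed

lemma decseq_pell_prod: "decseq pell_prod"
proof (rule decseq_SucI)
  show "pell_prod (Suc n) \<le> pell_prod n" for n
    using mult_left_mono[of "1 - 1 / 2 ^ (2 * n + 1)" 1 "pell_prod n"] pell_prod_pos[of n]
    by (simp add: pell_prod_Suc del: power_Suc)
qed

text \<open>With a = 1/2^(2n+1) the correction (4/3) a is the tail sum of the series of the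
  1/2^(2k+1), and monotonicity amounts to (1 - a) (1 - a/3) \<ge> 1 - (4/3) a.\<close>

lemma incseq_pell_prod_corrected:
  "incseq (\<lambda>n. pell_prod n * (1 - 4 / 3 * (1 / 2 ^ (2 * n + 1))))"
proof (rule incseq_SucI)
  fix n
  define a :: real where "a = 1 / 2 ^ (2 * n + 1)"
  have "1 - 4 / 3 * a \<le> (1 - a) * (1 - 4 / 3 * (a / 4))"
    by (simp add: algebra_simps)
  then have "pell_prod n * (1 - 4 / 3 * a) \<le> pell_prod n * ((1 - a) * (1 - 4 / 3 * (a / 4)))"
    using pell_prod_pos[of n] by (intro mult_left_mono) auto
  moreover have "1 / 2 ^ (2 * Suc n + 1) = a / 4"
    by (simp add: a_def)
  ultimately show "pell_prod n * (1 - 4 / 3 * (1 / 2 ^ (2 * n + 1)))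
      \<le> pell_prod (Suc n) * (1 - 4 / 3 * (1 / 2 ^ (2 * Suc n + 1)))"
    unfolding pell_prod_Suc by (simp only: a_def mult.assoc)
qed

text \<open>The digits 0.58057 are the decimal expansion cut off, not rounded. Eight factors
  suffice: the two bounds then differ by \<open>pell_prod 8\<close> times (4/3) / 2^17, less than 5
  * 10^(-6).\<close>

lemma pell_constant_bounds: "0.58057 \<le> pell_constant" "pell_constant < 0.58058"
proof -
  have "1 - pell_constant \<le> pell_prod 8"
    by (rule decseq_ge[OF decseq_pell_prod pell_prod_tendsto])
  moreover have "pell_prod 8 \<le> 1 - 0.58057"
    by (simp add: pell_prod_def lessThan_nat_numeral)
  ultimately show "0.58057 \<le> pell_constant" by linarith
  \<comment> \<open>The correction factor tends to 1, so the increasing sequence has the same limit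
    and each of its terms bounds that limit from below.\<close>
  have "(\<lambda>n. pell_prod n * (1 - 4 / 3 * (1 / 2 ^ (2 * n + 1))))
      \<longlonglongrightarrow> (1 - pell_constant) * (1 - 4 / 3 * 0)"
  proof (intro tendsto_intros pell_prod_tendsto)
    show "(\<lambda>n. 1 / (2::real) ^ (2 * n + 1)) \<longlonglongrightarrow> 0"
      using LIMSEQ_subseq_LIMSEQ[OF LIMSEQ_inverse_realpow_zero[of "2::real"], of "\<lambda>n. 2 * n + 1"]
      by (simp add: strict_mono_def o_def inverse_eq_divide)
  qed
  then have "pell_prod 8 * (1 - 4 / 3 * (1 / 2 ^ (2 * 8 + 1))) \<le> 1 - pell_constant"
    using incseq_le[OF incseq_pell_prod_corrected] by fastforce
  moreover have "1 - 0.58058 < pell_prod 8 * (1 - 4 / 3 * (1 / 2 ^ (2 * 8 + 1)))"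
    by (simp add: pell_prod_def lessThan_nat_numeral)
  ultimately show "pell_constant < 0.58058" by linarith
qed

text \<open>Convergence is asserted separately because \<open>lim\<close> alone would be an
  unspecified value for a divergent sequence. The roots \<open>i\<close> and \<open>s\<close> are
  arbitrary, so the result is independent of their choice.\<close>

theorem theorem3:
  fixes i s :: complex
  assumes "i\<^sup>2 = -1" and "s\<^sup>2 = -1/2"
  shows "convergent (\<lambda>j. F i s (-1/2) j)
       \<and> complex_of_real pell_constant = 1 - lim (\<lambda>j. F i s (-1/2) j)
       \<and> 0.58057 \<le> pell_constant \<and> pell_constant < 0.58058"
proof -
  \<comment> \<open>The norm of (-1/2)^k is 2^(-k) < 1, so no denominator of a Gaussian binomial
    vanishes.\<close>
  have q: "(- 1 / 2 :: complex) ^ k \<noteq> 1" if "1 \<le> k" for k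
  proof
    assume "(- 1 / 2 :: complex) ^ k = 1"
    then have "norm (- 1 / 2 :: complex) ^ k = 1"
      by (metis norm_one norm_power)
    then show False
      using that power_less_one_iff[of "1/2::real" k] by (simp add: norm_divide)
  qed
  have "F i s (-1/2) j = complex_of_real (pell_prod j)" for j
  proof -
    have "F i s (-1/2) j = (\<Prod>k<j. 1 + (-1/2) ^ (2 * k + 1))"
      using assms q by (intro F_eq_prod) (auto simp: field_simps)
    \<comment> \<open>Odd powers of -1/2 are negative, which turns each plus into the minus of the
      Pell product.\<close>
    also have "\<dots> = complex_of_real (pell_prod j)"
      unfolding pell_prod_def of_real_prod
      by (intro prod.cong) (auto simp: power_mult power_divide)
    finally show ?thesis .
  qed
  moreover have "(\<lambda>j. complex_of_real (pell_prod j)) \<longlonglongrightarrow> of_real (1 - pell_constant)"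
    by (intro tendsto_of_real pell_prod_tendsto)
  ultimately have lim: "(\<lambda>j. F i s (-1/2) j) \<longlonglongrightarrow> of_real (1 - pell_constant)"
    by simp
  show ?thesis
    using convergentI[OF lim] limI[OF lim] pell_constant_bounds by simp
qed

end
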